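(* Let $f:\mathbb{C}\to\mathbb{C}$ be a polynomial of degree $d>1$ with Julia set $J$, and let $\Gamma=(\mathcal V,\mathcal E)$ be a box chain model of $f$ on $J$. Let $\mathcal L$ be the minimum average cycle multiplier over all simple cycles in the graph $\Gamma$. Then for any $L>0$, there exists a box metric for which $\Gamma$ is box expansive by $L$ if and only if $L\le\mathcal L$.
   Context: The Julia set $J$ of a polynomial $f$ of degree $>1$ is the topological boundary of the set of points with bounded forward orbit. A closed box in $\mathbb{C}=\mathbb{R}^2$ is a set $[a,b]\times[c,d]$ with $a<b$, $c<d$. $\mathcal N(S,r)$ denotes the open $r$-neighborhood of $S$. Box chain model of $f$ on $J$: a directed graph $\Gamma=(\mathcal V,\mathcal E)$ (self-loops allowed) whose vertex set $\mathcal V=\{B_k\}_{k=1}^N$ is a finite collection of closed boxes with pairwise disjoint interiors and union containing $J$, such that for some $\delta>0$, $\mathcal E\supset\{(k,j): f(B_k)\cap\mathcal N(B_j,\delta)\ne\emptyset\}$, and such that $\Gamma$ is strongly connected. Here $(k,j)\in\mathcal E$ means there is an edge from $B_k$ to $B_j$. Multiplier of $B_k$: $\lambda_k=\min\{|f'(z)|:z\in B_k\}$. For an $n$-cycle of boxes $B_0\to\dots\to B_{n-1}\to B_n=B_0$ in $\Gamma$ ($n\ge1$), the cycle multiplier is $\lambda_0\cdots\lambda_{n-1}$ and the average cycle multiplier is $(\lambda_0\cdots\lambda_{n-1})^{1/n}$. A cycle is simple if it is composed of distinct vertices $B_0,\dots,B_{n-1}$. Box metric: a family $\Phi=\{\varphi_k\}_{k=1}^N$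 of positive constants (handicaps), one per box, inducing norms $|\mathbf v|_k=\varphi_k|\mathbf v|$ for $\mathbf v\in T_zB_k$ ($|\cdot|$ euclidean). $\Gamma$ is box expansive by $L$ for $\Phi$ if $|D_zf(\mathbf v)|_j\ge L|\mathbf v|_k$ for all $(k,j)\in\mathcal E$, $z\in B_k$, $\mathbf v\in T_zB_k$; equivalently $\varphi_j\lambda_k\ge L\varphi_k$ for all $(k,j)\in\mathcal E$. *)

theory Defs
  imports
    "HOL-Analysis.Analysis"
    "HOL-Computational_Algebra.Polynomial"
    "Graph_Theory.Pair_Digraph"
    "Graph_Theory.Digraph_Component"
begin

definition julia_set :: "(complex \<Rightarrow> complex) \<Rightarrow> complex set" where
  "julia_set f = frontier {z. bounded (range (\<lambda>n. (f ^^ n) z))}"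

definition closed_box :: "complex set \<Rightarrow> bool" where
  "closed_box B \<longleftrightarrow>
     (\<exists>a b c d. a < b \<and> c < d \<and> B = {z. Re z \<in> {a..b} \<and> Im z \<in> {c..d}})"

definition nbhd :: "complex set \<Rightarrow> real \<Rightarrow> complex set" where
  "nbhd S r = (\<Union>x\<in>S. ball x r)"

text \<open>
  The vertices are the boxes themselves: boxes have nonempty interior, so a family with pairwise
  disjoint interiors has no repetitions. An edge is the pair of its endpoints; self-loops are
  allowed, and there may be more edges than those forced by \<open>f\<close>.
\<close>

locale box_chain_model = pair_fin_digraph \<Gamma>
  for f :: "complex \<Rightarrow> complex" and \<Gamma> :: "complex set pair_pre_digraph" +
  assumes boxes: "\<And>B. B \<in> pverts \<Gamma> \<Longrightarrow> closed_box B"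
    and disjoint_interiors:
      "\<And>B C. \<lbrakk>B \<in> pverts \<Gamma>; C \<in> pverts \<Gamma>; B \<noteq> C\<rbrakk> \<Longrightarrow> interior B \<inter> interior C = {}"
    and julia_covered: "julia_set f \<subseteq> \<Union> (pverts \<Gamma>)"
    and edges: "\<exists>\<delta>>0. {(B, C). B \<in> pverts \<Gamma> \<and> C \<in> pverts \<Gamma> \<and> f ` B \<inter> nbhd C \<delta> \<noteq> {}} \<subseteq> parcs \<Gamma>"
    and strongly_conn: "strongly_connected (with_proj \<Gamma>)"

text \<open>The infimum is a minimum, by compactness; see \<open>multiplier_attained\<close> below.\<close>

definition multiplier :: "(complex \<Rightarrow> complex) \<Rightarrow> complex set \<Rightarrow> real" where
  "multiplier f B = Inf ((\<lambda>z. norm (deriv f z)) ` B)"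

text \<open>A cycle is given by its list of edges, so its boxes \<open>B\<^sub>0, \<dots>, B\<^sub>n\<^sub>-\<^sub>1\<close> are the tails of these edges.\<close>

definition cycle_multiplier ::
    "(complex \<Rightarrow> complex) \<Rightarrow> (complex set \<times> complex set) list \<Rightarrow> real" where
  "cycle_multiplier f c = (\<Prod>e\<leftarrow>c. multiplier f (fst e))"

definition avg_cycle_multiplier ::
    "(complex \<Rightarrow> complex) \<Rightarrow> (complex set \<times> complex set) list \<Rightarrow> real" where
  "avg_cycle_multiplier f c = root (length c) (cycle_multiplier f c)"

text \<open>
  \<open>pre_digraph.cycle\<close> holds of the nonempty closed walks without repeated vertices, that is, of the
  simple cycles, including self-loops. In a box chain model of a polynomial of degree greater than
  one there are finitely many of them and at least one: the graph is strongly connected, and if it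
  has a single box then this box contains the nonempty forward invariant set \<open>julia_set f\<close>, so it
  has a self-loop.
\<close>

definition min_avg_cycle_multiplier ::
    "(complex \<Rightarrow> complex) \<Rightarrow> complex set pair_pre_digraph \<Rightarrow> real" where
  "min_avg_cycle_multiplier f \<Gamma> =
     Min {avg_cycle_multiplier f c | c. pre_digraph.cycle (with_proj \<Gamma>) c}"

definition box_metric :: "complex set pair_pre_digraph \<Rightarrow> (complex set \<Rightarrow> real) \<Rightarrow> bool" where
  "box_metric \<Gamma> \<phi> \<longleftrightarrow> (\<forall>B \<in> pverts \<Gamma>. \<phi> B > 0)"

definition box_norm :: "(complex set \<Rightarrow> real) \<Rightarrow> complex set \<Rightarrow> complex \<Rightarrow> real" where
  "box_norm \<phi> B v = \<phi> B * norm v"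

text \<open>The tangent space at every point of a box, including boundary points, is all of \<open>\<complex>\<close>.\<close>

definition box_expansive ::
    "(complex \<Rightarrow> complex) \<Rightarrow> complex set pair_pre_digraph \<Rightarrow> (complex set \<Rightarrow> real) \<Rightarrow> real \<Rightarrow> bool" where
  "box_expansive f \<Gamma> \<phi> L \<longleftrightarrow>
     (\<forall>(B, C) \<in> parcs \<Gamma>. \<forall>z \<in> B. \<forall>v.
        box_norm \<phi> C (frechet_derivative f (at z) v) \<ge> L * box_norm \<phi> B v)"

lemma closed_box_compact:
  assumes "closed_box B"
  shows "compact B" "B \<noteq> {}"
proof -
  obtain a b c d where *: "a < b" "c < d" "B = {z. Re z \<in> {a..b} \<and> Im z \<in> {c..d}}"
    using assms unfolding closed_box_def by blast
  then have "B = cbox (Complex a c) (Complex b d)"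
    by (auto simp: in_cbox_complex_iff)
  then show "compact B" by simp
  have "Complex a c \<in> B" using * by simp
  then show "B \<noteq> {}" by blast
qed

lemma multiplier_attained:
  assumes "closed_box B"
  shows "\<exists>z\<in>B. multiplier (poly p) B = norm (deriv (poly p) z) \<and>
           (\<forall>w\<in>B. norm (deriv (poly p) z) \<le> norm (deriv (poly p) w))"
proof -
  have d: "deriv (poly p) = poly (pderiv p)"
    by (rule ext, rule DERIV_imp_deriv, rule poly_DERIV)
  have "continuous_on B (\<lambda>z. norm (deriv (poly p) z))"
    unfolding d by (intro continuous_intros)
  then obtain z where z: "z \<in> B" "\<forall>w\<in>B. norm (deriv (poly p) z) \<le> norm (deriv (poly p) w)"
    using continuous_attains_inf closed_box_compact[OF assms] by meson
  moreover have "multiplier (poly p) B = norm (deriv (poly p) z)"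
    unfolding multiplier_def using z by (intro cInf_eq_minimum) auto
  ultimately show ?thesis by blast
qed

end

theory Submission
  imports Defs "HOL-Computational_Algebra.Fundamental_Theorem_Algebra"
begin

text \<open>
  Expansiveness by \<open>L\<close> means \<open>\<phi>\<^sub>k \<le> w\<^sub>k \<phi>\<^sub>j\<close> along every edge, where \<open>w\<^sub>k = \<lambda>\<^sub>k / L\<close>. Multiplying around a
  cycle, the handicaps cancel and the product of the weights is at least one. Conversely, if
  all simple cycles have weight at least one, let \<open>\<phi>\<^sub>k\<close> be the least weight of a simple path from \<open>B\<^sub>k\<close>
  to a fixed box: prepending an edge to a simple path either gives a simple path or closes a simple
  cycle, and removing that cycle does not increase the weight.

  For the minimum to range over a nonempty set, the graph needs an edge. It has one because the
  Julia set is nonempty and forward invariant.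
\<close>

section \<open>Potentials on weighted digraphs\<close>

lemma (in fin_digraph) finite_cycles: "finite {c. cycle c}"
proof (rule finite_subset)
  show "{c. cycle c} \<subseteq> {c. set c \<subseteq> arcs G \<and> distinct c}"
    by (auto simp: cycle_conv)
qed (rule finite_subset_distinct, simp)

text \<open>\<open>cycle\<close> asks for distinct vertices only after dropping the first one
  visited. For \<open>e # p\<close> those are the vertices of \<open>p\<close>, distinct by
  \<open>apath\<close>.\<close>

lemma (in wf_digraph) apath_Cons_imp_cycle:
  assumes "e \<in> arcs G" "apath (head G e) p (tail G e)"
  shows "cycle (e # p)"
  unfolding cycle_def
  by (rule exI[of _ "tail G e"]) (use assms in \<open>auto simp: apath_def awalk_Cons_iff\<close>)

text \<open>The return path from head to tail can be chosen simple. This serves twice: to produce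
  some cycle, and to rule out edges of weight zero.\<close>

lemma (in wf_digraph) strongly_connected_arc_in_cycle:
  assumes "strongly_connected G" "e \<in> arcs G"
  obtains p where "cycle (e # p)"
proof -
  have "head G e \<rightarrow>\<^sup>*\<^bsub>G\<^esub> tail G e"
    using assms by (auto simp: strongly_connected_def)
  then show thesis
    using that apath_Cons_imp_cycle[OF assms(2)] by (auto simp: reachable_apath)
qed

text \<open>The edge inequalities telescope: a nonnegative \<open>w e\<close> preserves the bound
  for the rest of the walk when multiplied into it.\<close>

lemma (in wf_digraph) potential_awalk:
  fixes w :: "'b \<Rightarrow> real"
  assumes "awalk u p v"
    and nonneg: "\<And>e. e \<in> arcs G \<Longrightarrow> 0 \<le> w e"
    and potential: "\<And>e. e \<in> arcs G \<Longrightarrow> \<phi> (tail G e) \<le> w e * \<phi> (head G e)"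
  shows "\<phi> u \<le> prod_list (map w p) * \<phi> v"
  using assms(1)
proof (induction p arbitrary: u)
  case Nil
  then show ?case by (simp add: awalk_Nil_iff)
next
  case (Cons e p)
  then have e: "e \<in> arcs G" "u = tail G e" and p: "awalk (head G e) p v"
    by (simp_all add: awalk_Cons_iff)
  have "\<phi> u \<le> w e * \<phi> (head G e)"
    using e potential by simp
  also have "\<dots> \<le> w e * (prod_list (map w p) * \<phi> v)"
    using Cons.IH[OF p] nonneg[OF e(1)] by (rule mult_left_mono)
  finally show ?case by (simp add: mult.assoc)
qed

lemma (in wf_digraph) potential_imp_cycle_weight:
  fixes w :: "'b \<Rightarrow> real"
  assumes "cycle c"
    and "\<And>e. e \<in> arcs G \<Longrightarrow> 0 \<le> w e"
    and "\<And>e. e \<in> arcs G \<Longrightarrow> \<phi> (tail G e) \<le> w e * \<phi> (head G e)"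
    and pos: "\<And>v. v \<in> verts G \<Longrightarrow> 0 < \<phi> v"
  shows "1 \<le> prod_list (map w c)"
proof -
  obtain u where u: "awalk u c u"
    using assms(1) by (auto simp: cycle_def)
  have "\<phi> u \<le> prod_list (map w c) * \<phi> u"
    using u assms(2,3) by (rule potential_awalk)
  then show ?thesis
    using pos[of u] u by (auto simp: mult_le_cancel_right1 awalk_def)
qed

lemma prod_list_pos:
  fixes xs :: "real list"
  assumes "\<And>x. x \<in> set xs \<Longrightarrow> 0 < x"
  shows "0 < prod_list xs"
  using assms by (induction xs) auto

text \<open>In logarithms, these are shortest-path potentials in a graph without negative cycles.
  Simple paths give finitely many candidates for the minimum, strong connectivity at least
  one.\<close>

lemma (in fin_digraph) cycle_weights_imp_potential:
  fixes w :: "'b \<Rightarrow> real"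
  assumes conn: "strongly_connected G"
    and pos: "\<And>e. e \<in> arcs G \<Longrightarrow> 0 < w e"
    and cycles: "\<And>c. cycle c \<Longrightarrow> 1 \<le> prod_list (map w c)"
  obtains \<phi> where "\<And>v. v \<in> verts G \<Longrightarrow> 0 < \<phi> v"
    and "\<And>e. e \<in> arcs G \<Longrightarrow> \<phi> (tail G e) \<le> w e * \<phi> (head G e)"
proof -
  define weight where "weight p = prod_list (map w p)" for p
  obtain r where r: "r \<in> verts G"
    using conn by (auto simp: strongly_connected_def)
  define \<phi> where "\<phi> v = Min (weight ` {p. apath v p r})" for v
  have fin: "finite (weight ` {p. apath v p r})" for v
    by (intro finite_imageI apaths_finite)
  have weight_pos: "0 < weight p" if "set p \<subseteq> arcs G" for p
    unfolding weight_def using that pos by (intro prod_list_pos) auto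
  have le: "\<phi> v \<le> weight p" if "apath v p r" for v p
    unfolding \<phi>_def using that fin by (intro Min_le) auto
  have attained: "\<exists>p. apath v p r \<and> \<phi> v = weight p" if "v \<in> verts G" for v
  proof -
    have "v \<rightarrow>\<^sup>*\<^bsub>G\<^esub> r"
      using conn that r by (auto simp: strongly_connected_def)
    then have "weight ` {p. apath v p r} \<noteq> {}"
      by (auto simp: reachable_apath)
    from Min_in[OF fin this] show ?thesis
      unfolding \<phi>_def by auto
  qed
  show thesis
  proof
    fix v assume "v \<in> verts G"
    then obtain p where "apath v p r" "\<phi> v = weight p"
      using attained by blast
    then show "0 < \<phi> v"
      using weight_pos by (auto simp: apath_def awalk_def)
  next
    fix e assume e: "e \<in> arcs G"
    then obtain p where p: "apath (head G e) p r" "\<phi> (head G e) = weight p"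
      using attained by (meson head_in_verts)
    show "\<phi> (tail G e) \<le> w e * \<phi> (head G e)"
    proof (cases "tail G e \<in> set (awalk_verts (head G e) p)")
      case False
      then have "apath (tail G e) (e # p) r"
        using e p(1) by (simp add: apath_Cons_iff)
      from le[OF this] show ?thesis
        by (simp add: p(2) weight_def)
    next
      case True
      have "awalk (head G e) p r"
        using p(1) by (simp add: apath_def)
      \<comment> \<open>Cut \<open>p\<close> at the tail of \<open>e\<close>: \<open>e # q\<close>
        is the cycle to remove, \<open>s\<close> the simple path left over. For a self-loop
        \<open>q\<close> is empty.\<close>
      then obtain q s where qs: "p = q @ s"
        "awalk (head G e) q (tail G e)" "awalk (tail G e) s r"
        using True awalk_decomp by blast
      have q: "apath (head G e) q (tail G e)" and s: "apath (tail G e) s r"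
        using p(1) qs by (simp_all add: apath_append_iff)
      have "1 \<le> weight (e # q)"
        unfolding weight_def by (intro cycles apath_Cons_imp_cycle e q)
      moreover have "0 < weight s"
        using s by (intro weight_pos) (auto simp: apath_def awalk_def)
      ultimately have "weight s \<le> weight (e # q) * weight s"
        by simp
      also have "\<dots> = w e * \<phi> (head G e)"
        by (simp add: p(2) qs(1) weight_def)
      finally show ?thesis
        using le[OF s] by linarith
    qed
  qed
qed

section \<open>The Julia set of a polynomial\<close>

text \<open>The two orbits differ by at most the single point \<open>z\<close>.\<close>

lemma bounded_orbit_iff:
  fixes f :: "'a::metric_space \<Rightarrow> 'a"
  shows "bounded (range (\<lambda>n. (f ^^ n) (f z))) \<longleftrightarrow> bounded (range (\<lambda>n. (f ^^ n) z))"
proof -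
  have "range (\<lambda>n. (f ^^ n) z) = (\<lambda>n. (f ^^ n) z) ` insert 0 (range Suc)"
    by (simp flip: UNIV_nat_eq)
  also have "\<dots> = insert z (range (\<lambda>n. (f ^^ n) (f z)))"
    by (simp add: image_image funpow_swap1)
  finally have "range (\<lambda>n. (f ^^ n) z) = insert z (range (\<lambda>n. (f ^^ n) (f z)))" .
  then show ?thesis by simp
qed

text \<open>The set \<open>K\<close> of points with bounded orbit equals its own preimage.
  Continuity then pushes its closure forward into itself and pulls its interior back into
  itself.\<close>

lemma julia_set_forward_invariant:
  assumes cont: "continuous_on UNIV f" and z: "z \<in> julia_set f"
  shows "f z \<in> julia_set f"
proof -
  define K where "K = {z. bounded (range (\<lambda>n. (f ^^ n) z))}"
  have inv: "f -` K = K"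
    unfolding K_def by (auto simp: bounded_orbit_iff)
  have z': "z \<in> closure K" "z \<notin> interior K"
    using z by (auto simp: julia_set_def frontier_def K_def)
  have "f ` closure K \<subseteq> closure (f ` K)"
    using cont by (intro image_closure_subset)
      (auto intro: continuous_on_subset closure_subset[THEN subsetD])
  also have "\<dots> \<subseteq> closure K"
    using inv by (intro closure_mono) auto
  finally have "f z \<in> closure K"
    using z' by blast
  moreover have "f z \<notin> interior K"
  proof
    assume "f z \<in> interior K"
    moreover have "open (f -` interior K)"
      using cont open_vimage[OF open_interior] by blast
    moreover have "f -` interior K \<subseteq> K"
      using inv interior_subset[of K] by blast
    ultimately show False
      using z'(2) by (auto simp: interior_def)
  qed
  ultimately show ?thesis
    by (simp add: julia_set_def frontier_def K_def)
qed

text \<open>Write p(z) = a + z q(z). Degree above one makes \<open>q\<close> nonconstant, so |q(z)|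
  eventually exceeds 2 + |a|.\<close>

lemma poly_doubles_far_out:
  fixes p :: "complex poly"
  assumes "degree p > 1"
  obtains r where "r > 0" "\<And>z. r \<le> norm z \<Longrightarrow> 2 * norm z \<le> norm (poly p z)"
proof -
  obtain a q where p: "p = pCons a q"
    by (cases p)
  obtain b q' where q: "q = pCons b q'"
    by (cases q)
  have "q' \<noteq> 0"
    using assms by (auto simp: p q split: if_splits)
  from poly_infinity[OF this, of "2 + norm a" b]
  obtain r where r: "\<And>z. r \<le> norm z \<Longrightarrow> 2 + norm a \<le> norm (poly q z)"
    unfolding q by blast
  show thesis
  \<comment> \<open>Radius at least 1 gives |a| \<le> |z| |a|, which absorbs the constant
    term.\<close>
  proof (rule that[of "max 1 r"])
    fix z :: complex assume z: "max 1 r \<le> norm z"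
    have "2 * norm z + norm a \<le> norm z * (2 + norm a)"
      using z mult_right_mono[of 1 "norm z" "norm a"] by (simp add: algebra_simps)
    also have "\<dots> \<le> norm z * norm (poly q z)"
      using z r by (intro mult_left_mono) auto
    also have "\<dots> = norm (poly p z - a)"
      by (simp add: p norm_mult)
    also have "\<dots> \<le> norm (poly p z) + norm a"
      by (rule norm_triangle_ineq4)
    finally show "2 * norm z \<le> norm (poly p z)" by simp
  qed simp
qed

lemma poly_unbounded_orbit:
  fixes p :: "complex poly"
  assumes "degree p > 1"
  shows "\<exists>z. \<not> bounded (range (\<lambda>n. (poly p ^^ n) z))"
proof -
  obtain r where r: "r > 0" "\<And>z. r \<le> norm z \<Longrightarrow> 2 * norm z \<le> norm (poly p z)"
    using poly_doubles_far_out[OF assms] by blast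
  define z where "z = complex_of_real r"
  have grow: "2 ^ n * r \<le> norm ((poly p ^^ n) z)" for n
  proof (induction n)
    case 0
    then show ?case using r(1) by (simp add: z_def)
  next
    case (Suc n)
    \<comment> \<open>The iterate stays in the region where doubling applies.\<close>
    have "r \<le> 2 ^ n * r"
      using r(1) by simp
    then have "2 * norm ((poly p ^^ n) z) \<le> norm (poly p ((poly p ^^ n) z))"
      using Suc by (intro r(2)) linarith
    then show ?case using Suc by simp
  qed
  have "\<not> bounded (range (\<lambda>n. (poly p ^^ n) z))"
  proof
    assume "bounded (range (\<lambda>n. (poly p ^^ n) z))"
    then obtain M where M: "\<And>n. norm ((poly p ^^ n) z) \<le> M"
      by (auto simp: bounded_iff)
    obtain n where "M / r < 2 ^ n"
      using real_arch_pow[of 2 "M / r"] by auto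
    then have "M < 2 ^ n * r"
      using r(1) by (simp add: field_simps)
    then show False
      using grow[of n] M[of n] by linarith
  qed
  then show ?thesis by blast
qed

text \<open>A fixed point is a root of p(z) - z, whose degree is still that of \<open>p\<close> and
  hence positive.\<close>

lemma poly_fixed_point:
  fixes p :: "complex poly"
  assumes "degree p > 1"
  obtains z where "poly p z = z"
proof -
  have "degree (p - [:0, 1:]) = degree p"
    unfolding diff_conv_add_uminus using assms by (simp add: degree_add_eq_left)
  then have "\<not> constant (poly (p - [:0, 1:]))"
    using assms by (simp add: constant_degree)
  from fundamental_theorem_of_algebra[OF this] show thesis
    using that by auto
qed

text \<open>A fixed point has bounded orbit and some other point escapes; in the connected plane a
  nonempty proper subset has nonempty frontier.\<close>

lemma julia_set_poly_nonempty:
  fixes p :: "complex poly"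
  assumes "degree p > 1"
  shows "julia_set (poly p) \<noteq> {}"
proof -
  define K where "K = {z. bounded (range (\<lambda>n. (poly p ^^ n) z))}"
  obtain z where z: "poly p z = z"
    using poly_fixed_point[OF assms] .
  have "(poly p ^^ n) z = z" for n
    by (induction n) (simp_all add: z)
  then have "z \<in> K"
    by (simp add: K_def)
  moreover have "K \<noteq> UNIV"
    using poly_unbounded_orbit[OF assms] by (auto simp: K_def)
  ultimately have "frontier K \<noteq> {}"
    by (metis empty_iff frontier_not_empty)
  then show ?thesis
    by (simp add: julia_set_def K_def)
qed

section \<open>Box chain models\<close>

text \<open>A Julia point and its image both lie in boxes, and the image lies in every neighborhood
  of its own box, which forces an edge.\<close>

lemma (in box_chain_model) arc_exists:
  assumes "continuous_on UNIV f" "julia_set f \<noteq> {}"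
  shows "parcs \<Gamma> \<noteq> {}"
proof -
  obtain z where z: "z \<in> julia_set f"
    using assms(2) by blast
  then have "f z \<in> julia_set f"
    using julia_set_forward_invariant[OF assms(1)] by blast
  with z obtain B C where BC: "B \<in> pverts \<Gamma>" "C \<in> pverts \<Gamma>" "z \<in> B" "f z \<in> C"
    using julia_covered by blast
  obtain \<delta> where "\<delta> > 0"
    "{(B, C). B \<in> pverts \<Gamma> \<and> C \<in> pverts \<Gamma> \<and> f ` B \<inter> nbhd C \<delta> \<noteq> {}} \<subseteq> parcs \<Gamma>"
    using edges by blast
  moreover have "f z \<in> f ` B \<inter> nbhd C \<delta>"
    using BC \<open>\<delta> > 0\<close> by (auto simp: nbhd_def intro!: bexI[of _ "f z"])
  ultimately have "(B, C) \<in> parcs \<Gamma>"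
    using BC(1,2) by blast
  then show ?thesis by blast
qed

lemma multiplier_nonneg:
  assumes "closed_box B"
  shows "0 \<le> multiplier (poly p) B"
  using multiplier_attained[OF assms, of p] by auto

text \<open>The real derivative is multiplication by a complex number, so it stretches all tangent
  vectors by the same factor.\<close>

lemma frechet_derivative_poly:
  fixes p :: "complex poly"
  shows "frechet_derivative (poly p) (at z) v = deriv (poly p) z * v"
proof -
  have "(poly p has_derivative (*) (poly (pderiv p) z)) (at z)"
    using poly_DERIV[of p z] by (simp add: has_field_derivative_def)
  then have "frechet_derivative (poly p) (at z) = (*) (poly (pderiv p) z)"
    by (rule frechet_derivative_at[symmetric])
  moreover have "deriv (poly p) z = poly (pderiv p) z"
    by (intro DERIV_imp_deriv poly_DERIV)
  ultimately show ?thesis by simp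
qed

lemma (in box_chain_model) box_expansive_iff:
  assumes f: "f = poly p" and metric: "box_metric \<Gamma> \<phi>"
  shows "box_expansive f \<Gamma> \<phi> L \<longleftrightarrow>
    (\<forall>e\<in>parcs \<Gamma>. L * \<phi> (fst e) \<le> multiplier f (fst e) * \<phi> (snd e))"
proof -
  have "(\<forall>z\<in>B. \<forall>v. L * box_norm \<phi> B v \<le> box_norm \<phi> C (frechet_derivative f (at z) v)) \<longleftrightarrow>
      L * \<phi> B \<le> multiplier f B * \<phi> C" (is "?lhs \<longleftrightarrow> ?rhs")
    if "(B, C) \<in> parcs \<Gamma>" for B C
  proof -
    have B: "closed_box B" and pos: "0 < \<phi> C"
      using boxes in_arcsD1[OF that] metric in_arcsD2[OF that] by (auto simp: box_metric_def)
    obtain z where z: "z \<in> B" "multiplier f B = norm (deriv f z)"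
      and min: "\<And>w. w \<in> B \<Longrightarrow> multiplier f B \<le> norm (deriv f w)"
      using multiplier_attained[OF B, of p] unfolding f by force
    show ?thesis
    proof
      \<comment> \<open>Test with the unit vector at the point where |f'| attains its minimum over
        the box.\<close>
      assume ?lhs
      then have "L * box_norm \<phi> B 1 \<le> box_norm \<phi> C (frechet_derivative f (at z) 1)"
        using z(1) by blast
      then show ?rhs
        by (simp add: box_norm_def f frechet_derivative_poly z(2)[unfolded f] mult.commute)
    next
      assume rhs: ?rhs
      show ?lhs
      proof (intro ballI allI)
        fix w v :: complex assume "w \<in> B"
        then have "L * \<phi> B \<le> norm (deriv f w) * \<phi> C"
          using rhs mult_right_mono[OF min[of w], of "\<phi> C"] pos by linarith
        then have "L * \<phi> B * norm v \<le> norm (deriv f w) * \<phi> C * norm v"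
          by (rule mult_right_mono) simp
        then show "L * box_norm \<phi> B v \<le> box_norm \<phi> C (frechet_derivative f (at w) v)"
          by (simp add: box_norm_def f frechet_derivative_poly norm_mult mult_ac)
      qed
    qed
  qed
  then show ?thesis
    unfolding box_expansive_def by fastforce
qed

lemma prod_list_map_divide:
  fixes f :: "'a \<Rightarrow> 'b::field"
  shows "prod_list (map (\<lambda>x. f x / c) xs) = prod_list (map f xs) / c ^ length xs"
  by (induction xs) simp_all

text \<open>Roots of positive order are strictly increasing on all reals. Nonemptiness of
  \<open>c\<close> matters, since \<open>root 0\<close> is constantly 0.\<close>

lemma le_avg_cycle_multiplier_iff:
  assumes "L > 0" "c \<noteq> []"
  shows "L \<le> avg_cycle_multiplier f c \<longleftrightarrow>
    1 \<le> prod_list (map (\<lambda>e. multiplier f (fst e) / L) c)"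
proof -
  have "L \<le> avg_cycle_multiplier f c \<longleftrightarrow>
      root (length c) (L ^ length c) \<le> root (length c) (cycle_multiplier f c)"
    using assms by (simp add: avg_cycle_multiplier_def real_root_power_cancel)
  also have "\<dots> \<longleftrightarrow> L ^ length c \<le> cycle_multiplier f c"
    using assms by (intro real_root_le_iff) simp
  also have "\<dots> \<longleftrightarrow> 1 \<le> prod_list (map (\<lambda>e. multiplier f (fst e) / L) c)"
    using assms by (simp add: prod_list_map_divide cycle_multiplier_def)
  finally show ?thesis .
qed

theorem proposition1p7:
  fixes p :: "complex poly"
    and \<Gamma> :: "complex set pair_pre_digraph"
    and L :: real
  assumes "degree p > 1"
    and "box_chain_model (poly p) \<Gamma>"
    and "L > 0"
  shows "(\<exists>\<phi>. box_metric \<Gamma> \<phi> \<and> box_expansive (poly p) \<Gamma> \<phi> L) \<longleftrightarrow>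
           L \<le> min_avg_cycle_multiplier (poly p) \<Gamma>"
proof -
  interpret box_chain_model "poly p" \<Gamma> by fact
  define w where "w e = multiplier (poly p) (fst e) / L" for e :: "complex set \<times> complex set"
  have w_nonneg: "0 \<le> w e" if "e \<in> parcs \<Gamma>" for e
    using multiplier_nonneg[OF boxes[OF arc_fst_in_verts[OF that]], of p] \<open>L > 0\<close>
    by (simp add: w_def)
  have expansive: "box_expansive (poly p) \<Gamma> \<phi> L \<longleftrightarrow>
      (\<forall>e\<in>parcs \<Gamma>. \<phi> (fst e) \<le> w e * \<phi> (snd e))" if "box_metric \<Gamma> \<phi>" for \<phi>
    using \<open>L > 0\<close> by (auto simp: box_expansive_iff[OF refl that] w_def field_simps)
  obtain e where "e \<in> parcs \<Gamma>"
    using arc_exists julia_set_poly_nonempty[OF assms(1)] by (fastforce intro: continuous_intros)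
  \<comment> \<open>This cycle makes the set under \<open>Min\<close> nonempty, so that comparing
    with the minimum means comparing with every cycle.\<close>
  then obtain c\<^sub>0 where "cycle c\<^sub>0"
    using strongly_connected_arc_in_cycle[OF strongly_conn] by metis
  moreover have "finite {avg_cycle_multiplier (poly p) c | c. cycle c}"
    using finite_cycles by simp
  ultimately have "L \<le> min_avg_cycle_multiplier (poly p) \<Gamma> \<longleftrightarrow>
      (\<forall>c. cycle c \<longrightarrow> L \<le> avg_cycle_multiplier (poly p) c)"
    unfolding min_avg_cycle_multiplier_def by (subst Min_ge_iff) auto
  also have "\<dots> \<longleftrightarrow> (\<forall>c. cycle c \<longrightarrow> 1 \<le> prod_list (map w c))"
    using le_avg_cycle_multiplier_iff[OF \<open>L > 0\<close>] by (auto simp: w_def[abs_def] cycle_def)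
  also have "\<dots> \<longleftrightarrow> (\<exists>\<phi>. box_metric \<Gamma> \<phi> \<and> box_expansive (poly p) \<Gamma> \<phi> L)"
  proof
    assume cycles: "\<forall>c. cycle c \<longrightarrow> 1 \<le> prod_list (map w c)"
    \<comment> \<open>A zero weight would annihilate the product around a simple cycle through
      \<open>e\<close>. So the cycle condition excludes critical points from the boxes.\<close>
    have w_pos: "0 < w e" if e: "e \<in> parcs \<Gamma>" for e
    proof -
      obtain q where "cycle (e # q)"
        using strongly_connected_arc_in_cycle[OF strongly_conn e] .
      then have "1 \<le> w e * prod_list (map w q)"
        using cycles by fastforce
      then have "w e \<noteq> 0" by auto
      then show ?thesis using w_nonneg[OF e] by simp
    qed
    obtain \<phi> where "\<And>B. B \<in> pverts \<Gamma> \<Longrightarrow> 0 < \<phi> B"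
      "\<And>e. e \<in> parcs \<Gamma> \<Longrightarrow> \<phi> (fst e) \<le> w e * \<phi> (snd e)"
      using cycle_weights_imp_potential[OF strongly_conn, of w] w_pos cycles by blast
    then show "\<exists>\<phi>. box_metric \<Gamma> \<phi> \<and> box_expansive (poly p) \<Gamma> \<phi> L"
      unfolding box_metric_def by (intro exI[of _ \<phi>]) (simp add: expansive box_metric_def)
  next
    assume "\<exists>\<phi>. box_metric \<Gamma> \<phi> \<and> box_expansive (poly p) \<Gamma> \<phi> L"
    then obtain \<phi> where "\<And>B. B \<in> pverts \<Gamma> \<Longrightarrow> 0 < \<phi> B"
      "\<And>e. e \<in> parcs \<Gamma> \<Longrightarrow> \<phi> (fst e) \<le> w e * \<phi> (snd e)"
      using expansive by (auto simp: box_metric_def)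
    then show "\<forall>c. cycle c \<longrightarrow> 1 \<le> prod_list (map w c)"
      using potential_imp_cycle_weight[where w = w and \<phi> = \<phi>] w_nonneg by blast
  qed
  finally show ?thesis by blast
qed

end
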